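(* Let $r,s,n$ be positive integers and let $F\subset K$ be algebraically closed fields of characteristic not $2$. Then there is a sums-of-squares formula of type $[r,s,n]$ over $F$ if and only if there is one over $K$.
   Context: Let $F$ be a field of characteristic not $2$. A sums-of-squares formula of type $[r,s,n]$ over $F$ is a polynomial identity $(x_1^2+\cdots+x_r^2)(y_1^2+\cdots+y_s^2)=z_1^2+\cdots+z_n^2$ in the polynomial ring $F[x_1,\dots,x_r,y_1,\dots,y_s]$, where each $z_i$ is a bilinear expression in the $x$'s and $y$'s over $F$, i.e. $z_i=\sum_{j,k}\alpha_{ijk}x_jy_k$ with $\alpha_{ijk}\in F$. *)

theory Defs
  imports
    "HOL-Library.Poly_Mapping"
    "HOL-Computational_Algebra.Computational_Algebra"
begin

datatype var = X nat | Y nat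

text \<open>
  The polynomial ring in the variables \<open>X 1, X 2, \<dots>\<close> and \<open>Y 1, Y 2, \<dots>\<close>: finitely supported
  maps from monomials (finitely supported exponent vectors) to coefficients, with convolution
  as the product. It contains \<open>F[x_1, \<dots>, x_r, y_1, \<dots>, y_s]\<close> for all \<open>r\<close> and \<open>s\<close> as a subring.
\<close>

type_synonym 'a xypoly = "(var \<Rightarrow>\<^sub>0 nat) \<Rightarrow>\<^sub>0 'a"

definition poly_const :: "'a::comm_ring_1 \<Rightarrow> 'a xypoly" where
  "poly_const c = Poly_Mapping.single 0 c"

definition poly_var :: "var \<Rightarrow> 'a::comm_ring_1 xypoly" where
  "poly_var v = Poly_Mapping.single (Poly_Mapping.single v 1) 1"

definition bilinear_expr :: "nat \<Rightarrow> nat \<Rightarrow> 'a::comm_ring_1 xypoly \<Rightarrow> bool" where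
  "bilinear_expr r s z \<longleftrightarrow>
     (\<exists>\<alpha>. z = (\<Sum>j=1..r. \<Sum>k=1..s. poly_const (\<alpha> j k) * poly_var (X j) * poly_var (Y k)))"

definition sos_formula :: "nat \<Rightarrow> nat \<Rightarrow> nat \<Rightarrow> (nat \<Rightarrow> 'a::comm_ring_1 xypoly) \<Rightarrow> bool" where
  "sos_formula r s n z \<longleftrightarrow>
     (\<forall>i\<in>{1..n}. bilinear_expr r s (z i)) \<and>
     (\<Sum>j=1..r. poly_var (X j) ^ 2) * (\<Sum>k=1..s. poly_var (Y k) ^ 2) = (\<Sum>i=1..n. z i ^ 2)"

end

theory Submission
  imports Defs
begin

text \<open>
  A formula of type \<open>[r,s,n]\<close> is a solution, in its coefficients \<open>\<alpha>\<^sub>i\<^sub>j\<^sub>k\<close>, of a system of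
  polynomial equations with integer coefficients. Ring homomorphisms preserve solutions. Applied to
  \<open>\<iota>\<close>, this gives one direction. For the other, let \<open>B\<close> be the \<open>F\<close>-subalgebra of \<open>K\<close> generated by
  the finitely many coefficients of a formula over \<open>K\<close>; an \<open>F\<close>-algebra homomorphism \<open>B \<rightarrow> F\<close> carries
  the formula to one over \<open>F\<close>.

  That such a homomorphism exists is the weak Nullstellensatz for the domain \<open>B\<close>. An induction on
  the number of generators proves it, once the claim is strengthened: for every nonzero \<open>g \<in> B\<close>
  some homomorphism \<open>B \<rightarrow> F\<close> does not vanish at \<open>g\<close>. To pass from \<open>B\<close> to \<open>B[a]\<close>, write \<open>g = q(a)\<close>.
  If \<open>a\<close> is transcendental over \<open>B\<close>, take \<open>\<phi>\<close> that does not kill the leading coefficient of \<open>q\<close> and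
  send \<open>a\<close> to a \<open>t \<in> F\<close> that is no root of the image of \<open>q\<close> under \<open>\<phi>\<close>. If \<open>a\<close> is algebraic, let \<open>p\<close>
  be a nonzero polynomial over \<open>B\<close> of least degree with root \<open>a\<close>, and let \<open>h\<close> be a nonzero multiple of
  \<open>g\<close> in \<open>B[a]\<close> that lies in \<open>B\<close>. Take \<open>\<phi>\<close> that kills neither the leading coefficient of \<open>p\<close> nor \<open>h\<close>,
  and send \<open>a\<close> to a root of the image of \<open>p\<close>. Pseudo-division by \<open>p\<close> shows that this is
  well defined, and \<open>g\<close> survives because its multiple \<open>h\<close> does.
\<close>

section \<open>Polynomials with coefficients in a subring\<close>

locale subring_of =
  fixes B :: "'a::idom set"
  assumes zero: "0 \<in> B" and one: "1 \<in> B"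
    and add: "x \<in> B \<Longrightarrow> y \<in> B \<Longrightarrow> x + y \<in> B"
    and uminus: "x \<in> B \<Longrightarrow> - x \<in> B"
    and mult: "x \<in> B \<Longrightarrow> y \<in> B \<Longrightarrow> x * y \<in> B"

definition over :: "'a::zero set \<Rightarrow> 'a poly \<Rightarrow> bool" where
  "over B p \<longleftrightarrow> (\<forall>i. coeff p i \<in> B)"

definition adjoin :: "'a::comm_ring_1 set \<Rightarrow> 'a \<Rightarrow> 'a set" where
  "adjoin B a = {poly p a | p. over B p}"

context subring_of
begin

lemma diff: "x \<in> B \<Longrightarrow> y \<in> B \<Longrightarrow> x - y \<in> B"
  using add[of x "- y"] uminus[of y] by simp

lemma power: "x \<in> B \<Longrightarrow> x ^ k \<in> B"
  by (induction k) (auto intro: one mult)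

lemma sum: "(\<And>i. i \<in> I \<Longrightarrow> f i \<in> B) \<Longrightarrow> sum f I \<in> B"
  by (induction I rule: infinite_finite_induct) (auto intro: zero add)

lemma over_0: "over B 0"
  by (simp add: over_def zero)

lemma over_const: "c \<in> B \<Longrightarrow> over B [:c:]"
  by (auto simp: over_def coeff_pCons zero split: nat.splits)

lemma over_X: "over B [:0, 1:]"
  by (auto simp: over_def coeff_pCons zero one split: nat.splits)

lemma over_add: "over B p \<Longrightarrow> over B q \<Longrightarrow> over B (p + q)"
  by (simp add: over_def add)

lemma over_uminus: "over B p \<Longrightarrow> over B (- p)"
  by (simp add: over_def uminus)

lemma over_diff: "over B p \<Longrightarrow> over B q \<Longrightarrow> over B (p - q)"
  by (simp add: over_def diff)

lemma over_smult: "c \<in> B \<Longrightarrow> over B p \<Longrightarrow> over B (smult c p)"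
  by (simp add: over_def mult)

lemma over_monom: "c \<in> B \<Longrightarrow> over B (monom c k)"
  by (simp add: over_def zero)

lemma over_mult: "over B p \<Longrightarrow> over B q \<Longrightarrow> over B (p * q)"
  by (auto simp: over_def coeff_mult intro: sum mult)

lemma over_coeff: "over B p \<Longrightarrow> coeff p i \<in> B"
  by (simp add: over_def)

lemma subring_adjoin: "subring_of (adjoin B a)"
proof
  show "0 \<in> adjoin B a"
    unfolding adjoin_def using over_0 by force
  show "1 \<in> adjoin B a"
    unfolding adjoin_def using over_const[OF one] by force
  fix x y assume "x \<in> adjoin B a" "y \<in> adjoin B a"
  then obtain p q where pq: "over B p" "over B q" "x = poly p a" "y = poly q a"
    by (auto simp: adjoin_def)
  show "x + y \<in> adjoin B a"
    using over_add[OF pq(1,2)] pq(3,4) unfolding adjoin_def by force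
  show "x * y \<in> adjoin B a"
    using over_mult[OF pq(1,2)] pq(3,4) unfolding adjoin_def by force
next
  fix x assume "x \<in> adjoin B a"
  then obtain p where p: "over B p" "x = poly p a"
    by (auto simp: adjoin_def)
  show "- x \<in> adjoin B a"
    using over_uminus[OF p(1)] p(2) unfolding adjoin_def by force
qed

lemma subset_adjoin: "B \<subseteq> adjoin B a"
proof
  fix x assume "x \<in> B"
  then show "x \<in> adjoin B a"
    unfolding adjoin_def using over_const[of x] by force
qed

lemma generator_in_adjoin: "a \<in> adjoin B a"
  unfolding adjoin_def using over_X by force

text \<open>
  Unlike \<^const>\<open>pseudo_divmod\<close>, this records that quotient and remainder have coefficients in
  the subring.
\<close>
lemma pseudo_division:
  assumes p: "over B p" "p \<noteq> 0" and f: "over B f"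
  obtains k s r where "over B s" "over B r" "smult (lead_coeff p ^ k) f = s * p + r"
    "r = 0 \<or> degree r < degree p"
proof -
  let ?c = "lead_coeff p" and ?d = "degree p"
  \<comment> \<open>Induction on a strict bound \<open>n\<close> for the degree, so that \<open>n = 0\<close> covers \<open>f = 0\<close>.\<close>
  have "\<exists>k s r. over B s \<and> over B r \<and> smult (?c ^ k) f = s * p + r \<and> (\<forall>i\<ge>?d. coeff r i = 0)"
    if "over B f" "\<forall>i\<ge>n. coeff f i = 0" for n f
    using that
  proof (induction n arbitrary: f)
    case 0
    then have "f = 0" by (simp add: poly_eq_iff)
    then show ?case using over_0 by (intro exI[of _ 0]) auto
  next
    case (Suc n)
    show ?case
    proof (cases "n < ?d")
      case True
      then show ?thesis
        using Suc.prems over_0 by (intro exI[of _ 0] exI[of _ f]) auto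
    next
      case False
      define m where "m = monom (coeff f n) (n - ?d)"
      define f1 where "f1 = smult ?c f - m * p"
      have m: "over B m"
        using Suc.prems(1) unfolding m_def by (intro over_monom over_coeff)
      have f1: "over B f1"
        unfolding f1_def by (intro over_diff over_smult over_mult m p Suc.prems over_coeff)
      have "coeff f1 i = 0" if "i \<ge> n" for i
      proof (cases "i = n")
        case True
        then show ?thesis using False by (simp add: f1_def m_def coeff_monom_mult)
      next
        case neq: False
        then have "coeff f i = 0" "coeff p (i - (n - ?d)) = 0"
          using that False Suc.prems(2) by (auto intro!: coeff_eq_0)
        then show ?thesis by (simp add: f1_def m_def coeff_monom_mult)
      qed
      then obtain k s r where ksr: "over B s" "over B r" "smult (?c ^ k) f1 = s * p + r"
          "\<forall>i\<ge>?d. coeff r i = 0"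
        using Suc.IH[OF f1] by blast
      have "smult (?c ^ Suc k) f = (s + smult (?c ^ k) m) * p + r"
        using ksr(3) by (simp add: f1_def algebra_simps smult_diff_right)
      moreover have "over B (s + smult (?c ^ k) m)"
        by (intro over_add ksr over_smult power over_coeff p m)
      ultimately show ?thesis using ksr(2,4) by blast
    qed
  qed
  from this[of f "Suc (degree f)"] f obtain k s r where
    "over B s" "over B r" "smult (?c ^ k) f = s * p + r" "\<forall>i\<ge>?d. coeff r i = 0"
    by (auto simp: coeff_eq_0)
  moreover from this(4) have "r = 0 \<or> degree r < ?d"
    by (metis leading_coeff_0_iff not_le_imp_less)
  ultimately show ?thesis using that by blast
qed

text \<open>
  Among the nonzero multiples of \<open>g = q(a)\<close> in \<open>B[a]\<close>, consider one of the form \<open>f(a)\<close> with \<open>f\<close> of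
  least degree. Division by \<open>p\<close> makes that degree smaller than the degree of \<open>p\<close>. Were \<open>f\<close> not
  constant, the remainder of \<open>p\<close> on division by \<open>f\<close> would give a multiple \<open>r(a)\<close> of smaller degree,
  hence zero, and the quotient would be a nonzero polynomial of smaller degree than \<open>p\<close> with root \<open>a\<close>.
\<close>
lemma algebraic_has_multiple_in_base:
  assumes p: "over B p" "p \<noteq> 0" "poly p a = 0"
    and min: "\<And>f. over B f \<Longrightarrow> poly f a = 0 \<Longrightarrow> f \<noteq> 0 \<Longrightarrow> degree p \<le> degree f"
    and q: "over B q" "poly q a \<noteq> 0"
  obtains u where "over B u" "poly u a * poly q a \<in> B" "poly u a * poly q a \<noteq> 0"
proof -
  define M where
    "M f \<longleftrightarrow> over B f \<and> poly f a \<noteq> 0 \<and> (\<exists>u. over B u \<and> poly u a * poly q a = poly f a)" for f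
  have "M q"
    using q over_const[OF one] unfolding M_def by (auto intro!: exI[of _ "[:1:]"])
  then obtain f where f: "M f" and fmin: "\<And>f'. M f' \<Longrightarrow> degree f \<le> degree f'"
    using ex_has_least_nat[of M q degree] by blast
  from f obtain u where u: "over B u" "poly u a * poly q a = poly f a"
    and f': "over B f" "poly f a \<noteq> 0" "f \<noteq> 0"
    unfolding M_def by (metis poly_0)
  have less: "degree f < degree p"
  proof -
    obtain k s r where ksr: "over B s" "over B r" "smult (lead_coeff p ^ k) f = s * p + r"
        "r = 0 \<or> degree r < degree p"
      using pseudo_division[OF p(1,2) f'(1)] by blast
    have ra: "poly r a = lead_coeff p ^ k * poly f a"
      using arg_cong[OF ksr(3), of "\<lambda>x. poly x a"] p(3) by simp
    then have "poly r a \<noteq> 0" using f' p by simp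
    moreover have "poly (smult (lead_coeff p ^ k) u) a * poly q a = poly r a"
      using u ra by (simp add: mult.assoc)
    moreover have "over B (smult (lead_coeff p ^ k) u)"
      by (intro over_smult power over_coeff p u)
    ultimately have "M r" using ksr(2) unfolding M_def by blast
    then have "degree f \<le> degree r" "r \<noteq> 0" using fmin \<open>poly r a \<noteq> 0\<close> by auto
    then show ?thesis using ksr(4) by simp
  qed
  have "degree f = 0"
  proof (rule ccontr)
    assume pos: "degree f \<noteq> 0"
    obtain k s r where ksr: "over B s" "over B r" "smult (lead_coeff f ^ k) p = s * f + r"
        "r = 0 \<or> degree r < degree f"
      using pseudo_division[OF f'(1,3) p(1)] by blast
    have ra: "poly r a = - poly s a * poly f a"
      using arg_cong[OF ksr(3), of "\<lambda>x. poly x a"] p(3) by (simp add: eq_neg_iff_add_eq_0 add.commute)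
    have "poly r a = 0"
    proof (rule ccontr)
      assume nz: "poly r a \<noteq> 0"
      have "poly (- (s * u)) a * poly q a = poly r a"
        using u(2) ra by (simp add: mult.assoc)
      moreover have "over B (- (s * u))"
        by (intro over_uminus over_mult u ksr)
      ultimately have "M r" using ksr(2) nz unfolding M_def by blast
      then show False using fmin[of r] ksr(4) nz by auto
    qed
    then have "poly s a = 0" using ra f' by simp
    moreover have "s \<noteq> 0"
    proof
      assume "s = 0"
      then have "r = smult (lead_coeff f ^ k) p" using ksr(3) by simp
      then have "degree p = degree r" "r \<noteq> 0" using f'(3) p(2) by simp_all
      then show False using ksr(4) less by simp
    qed
    ultimately have "degree p \<le> degree s" using min ksr(1) by blast
    moreover have "degree (s * f) = degree s + degree f"
      using \<open>s \<noteq> 0\<close> f'(3) by (rule degree_mult_eq)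
    ultimately have big: "degree (s * f) > degree p" using pos by simp
    then have "degree (s * f + r) = degree (s * f)"
      using ksr(4) less by (intro degree_add_eq_left) auto
    moreover have "degree (s * f + r) \<le> degree p"
      unfolding ksr(3)[symmetric] by (rule degree_smult_le)
    ultimately show False using big by simp
  qed
  then obtain h where "f = [:h:]" by (rule degree_eq_zeroE)
  then have "poly f a = coeff f 0" by simp
  then show ?thesis
    using that[OF u(1)] u(2) f' over_coeff[of f 0] by simp
qed

end


section \<open>Extending homomorphisms defined on a subring\<close>

text \<open>The values of \<open>\<phi>\<close> outside \<open>B\<close> are arbitrary.\<close>
locale partial_hom = subring_of B for B :: "'a::idom set" +
  fixes \<phi> :: "'a \<Rightarrow> 'b::idom"
  assumes hom_one: "\<phi> 1 = 1"
    and hom_add: "x \<in> B \<Longrightarrow> y \<in> B \<Longrightarrow> \<phi> (x + y) = \<phi> x + \<phi> y"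
    and hom_mult: "x \<in> B \<Longrightarrow> y \<in> B \<Longrightarrow> \<phi> (x * y) = \<phi> x * \<phi> y"
begin

lemma hom_zero: "\<phi> 0 = 0"
  using hom_add[OF zero zero] by (metis add_0_right add_left_cancel)

lemma hom_uminus: "x \<in> B \<Longrightarrow> \<phi> (- x) = - \<phi> x"
  using hom_add[of x "- x"] uminus[of x] hom_zero by (simp add: eq_neg_iff_add_eq_0 add.commute)

lemma hom_power: "x \<in> B \<Longrightarrow> \<phi> (x ^ k) = \<phi> x ^ k"
  by (induction k) (auto simp: hom_one hom_mult power)

lemma hom_sum: "(\<And>i. i \<in> I \<Longrightarrow> f i \<in> B) \<Longrightarrow> \<phi> (sum f I) = (\<Sum>i\<in>I. \<phi> (f i))"
  by (induction I rule: infinite_finite_induct) (auto simp: hom_zero hom_add sum)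

lemma coeff_map: "coeff (map_poly \<phi> p) i = \<phi> (coeff p i)"
  by (simp add: coeff_map_poly hom_zero)

lemma map_add: "over B p \<Longrightarrow> over B q \<Longrightarrow> map_poly \<phi> (p + q) = map_poly \<phi> p + map_poly \<phi> q"
  by (simp add: poly_eq_iff coeff_map hom_add over_def)

lemma map_uminus: "over B p \<Longrightarrow> map_poly \<phi> (- p) = - map_poly \<phi> p"
  by (simp add: poly_eq_iff coeff_map hom_uminus over_def)

lemma map_diff: "over B p \<Longrightarrow> over B q \<Longrightarrow> map_poly \<phi> (p - q) = map_poly \<phi> p - map_poly \<phi> q"
  using map_add[of p "- q"] map_uminus[of q] over_uminus[of q] by simp

lemma map_smult: "c \<in> B \<Longrightarrow> over B p \<Longrightarrow> map_poly \<phi> (smult c p) = smult (\<phi> c) (map_poly \<phi> p)"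
  by (simp add: poly_eq_iff coeff_map hom_mult over_def)

lemma map_mult: "over B p \<Longrightarrow> over B q \<Longrightarrow> map_poly \<phi> (p * q) = map_poly \<phi> p * map_poly \<phi> q"
  by (simp add: poly_eq_iff coeff_map coeff_mult hom_sum hom_mult mult over_def)

lemma map_const: "map_poly \<phi> [:c:] = [:\<phi> c:]"
  by (rule poly_eqI) (auto simp: coeff_map coeff_pCons hom_zero split: nat.splits)

text \<open>
  The only obstruction to extending \<open>\<phi>\<close> by \<open>a \<mapsto> t\<close>: each polynomial over \<open>B\<close> with root \<open>a\<close> must be
  mapped to one with root \<open>t\<close>.
\<close>
lemma extend_to_adjoin:
  assumes wd: "\<And>f. over B f \<Longrightarrow> poly f a = 0 \<Longrightarrow> poly (map_poly \<phi> f) t = 0"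
  obtains \<psi> where "partial_hom (adjoin B a) \<psi>"
    "\<And>f. over B f \<Longrightarrow> \<psi> (poly f a) = poly (map_poly \<phi> f) t" "\<And>x. x \<in> B \<Longrightarrow> \<psi> x = \<phi> x"
proof -
  define \<psi> where "\<psi> x = poly (map_poly \<phi> (SOME f. over B f \<and> poly f a = x)) t" for x
  have \<psi>: "\<psi> (poly f a) = poly (map_poly \<phi> f) t" if f: "over B f" for f
  proof -
    define f' where "f' = (SOME f'. over B f' \<and> poly f' a = poly f a)"
    have f': "over B f'" "poly f' a = poly f a"
      using someI[of "\<lambda>f'. over B f' \<and> poly f' a = poly f a" f] f unfolding f'_def by auto
    have "poly (map_poly \<phi> (f' - f)) t = 0"
      using f f' by (intro wd over_diff) auto
    then show ?thesis
      using f f' unfolding \<psi>_def f'_def[symmetric] by (simp add: map_diff)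
  qed
  have B: "\<psi> x = \<phi> x" if "x \<in> B" for x
    using \<psi>[OF over_const[OF that]] by (simp add: map_const)
  interpret A: subring_of "adjoin B a" by (rule subring_adjoin)
  have "partial_hom (adjoin B a) \<psi>"
  proof
    show "\<psi> 1 = 1" using B[OF one] hom_one by simp
    fix x y assume "x \<in> adjoin B a" "y \<in> adjoin B a"
    then obtain p q where pq: "over B p" "over B q" "x = poly p a" "y = poly q a"
      by (auto simp: adjoin_def)
    show "\<psi> (x + y) = \<psi> x + \<psi> y"
      using \<psi>[OF over_add[OF pq(1,2)]] pq by (simp add: \<psi> map_add)
    show "\<psi> (x * y) = \<psi> x * \<psi> y"
      using \<psi>[OF over_mult[OF pq(1,2)]] pq by (simp add: \<psi> map_mult)
  qed
  then show ?thesis using \<psi> B that by blast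
qed

text \<open>
  A polynomial \<open>f\<close> over \<open>B\<close> with root \<open>a\<close> is divisible by \<open>p\<close> up to a power of the leading
  coefficient \<open>c\<close> of \<open>p\<close>, since the remainder has root \<open>a\<close> and too small a degree. Applying \<open>\<phi>\<close>,
  which does not kill \<open>c\<close>, shows that \<open>t\<close> is a root of the image of \<open>f\<close>.
\<close>
lemma minimal_relation_suffices:
  assumes p: "over B p" "p \<noteq> 0" "poly p a = 0"
    and min: "\<And>f. over B f \<Longrightarrow> poly f a = 0 \<Longrightarrow> f \<noteq> 0 \<Longrightarrow> degree p \<le> degree f"
    and c: "\<phi> (lead_coeff p) \<noteq> 0" and t: "poly (map_poly \<phi> p) t = 0"
    and f: "over B f" "poly f a = 0"
  shows "poly (map_poly \<phi> f) t = 0"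
proof -
  obtain k s r where ksr: "over B s" "over B r" "smult (lead_coeff p ^ k) f = s * p + r"
      "r = 0 \<or> degree r < degree p"
    using pseudo_division[OF p(1,2) f(1)] by blast
  have "poly r a = 0"
    using arg_cong[OF ksr(3), of "\<lambda>x. poly x a"] p(3) f(2) by simp
  then have "r = 0" using min[of r] ksr(2,4) by linarith
  then have "map_poly \<phi> (smult (lead_coeff p ^ k) f) = map_poly \<phi> (s * p)"
    using ksr(3) by simp
  then have "smult (\<phi> (lead_coeff p) ^ k) (map_poly \<phi> f) = map_poly \<phi> s * map_poly \<phi> p"
    using f p ksr(1) by (simp add: map_smult map_mult hom_power power over_coeff)
  from arg_cong[OF this, of "\<lambda>x. poly x t"] show ?thesis
    using t c by simp
qed

end


section \<open>Homomorphisms from finitely generated algebras to the base field\<close>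

text \<open>
  For a domain \<open>B\<close> of finite type over an algebraically closed field, this says that no nonzero
  element of \<open>B\<close> vanishes at every closed point of its spectrum.
\<close>
definition enough_points :: "('f::field \<Rightarrow> 'k::field) \<Rightarrow> 'k set \<Rightarrow> bool" where
  "enough_points \<iota> B \<longleftrightarrow> subring_of B \<and> range \<iota> \<subseteq> B \<and>
     (\<forall>g\<in>B. g \<noteq> 0 \<longrightarrow> (\<exists>\<phi>. partial_hom B \<phi> \<and> (\<forall>c. \<phi> (\<iota> c) = c) \<and> \<phi> g \<noteq> 0))"

text \<open>A nonconstant polynomial over an algebraically closed field even takes the value 1.\<close>
lemma alg_closed_poly_nonzero_value:
  fixes p :: "'a::alg_closed_field poly"
  assumes "p \<noteq> 0"
  obtains t where "poly p t \<noteq> 0"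
proof (cases "degree p = 0")
  case True
  then obtain c where "p = [:c:]" by (rule degree_eq_zeroE)
  then show ?thesis using assms that[of 0] by simp
next
  case False
  have "degree (p + [:- 1:]) = degree p"
    using False by (intro degree_add_eq_left) simp
  then obtain t where "poly (p + [:- 1:]) t = 0"
    using False alg_closed_imp_poly_has_root[of "p + [:- 1:]"] by auto
  then show ?thesis using that[of t] by simp
qed

lemma enough_points_adjoin:
  fixes \<iota> :: "'f::alg_closed_field \<Rightarrow> 'k::field"
  assumes "enough_points \<iota> B"
  shows "enough_points \<iota> (adjoin B a)"
proof -
  interpret subring_of B using assms by (simp add: enough_points_def)
  have \<iota>: "\<iota> c \<in> B" for c using assms by (auto simp: enough_points_def)
  have "\<exists>\<psi>. partial_hom (adjoin B a) \<psi> \<and> (\<forall>c. \<psi> (\<iota> c) = c) \<and> \<psi> g \<noteq> 0"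
    if g: "g \<in> adjoin B a" "g \<noteq> 0" for g
  proof -
    obtain q where q: "over B q" "g = poly q a" "poly q a \<noteq> 0"
      using g by (auto simp: adjoin_def)
    then have "q \<noteq> 0" by auto
    show ?thesis
    proof (cases "\<exists>p. over B p \<and> poly p a = 0 \<and> p \<noteq> 0")
      case False
      have "lead_coeff q \<noteq> 0" using \<open>q \<noteq> 0\<close> by simp
      then obtain \<phi> where \<phi>: "partial_hom B \<phi>" "\<forall>c. \<phi> (\<iota> c) = c" "\<phi> (lead_coeff q) \<noteq> 0"
        using assms over_coeff[OF q(1)] unfolding enough_points_def by metis
      interpret partial_hom B \<phi> by fact
      have "map_poly \<phi> q \<noteq> 0"
        using \<phi>(3) coeff_map[of q "degree q"] by auto
      then obtain t where t: "poly (map_poly \<phi> q) t \<noteq> 0"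
        by (rule alg_closed_poly_nonzero_value)
      \<comment> \<open>Only the zero polynomial has root \<open>a\<close>, so every \<open>t\<close> is an admissible image of \<open>a\<close>.\<close>
      have "poly (map_poly \<phi> f) t = 0" if "over B f" "poly f a = 0" for f
        using False that by auto
      then obtain \<psi> where "partial_hom (adjoin B a) \<psi>"
          "\<And>f. over B f \<Longrightarrow> \<psi> (poly f a) = poly (map_poly \<phi> f) t" "\<And>x. x \<in> B \<Longrightarrow> \<psi> x = \<phi> x"
        using extend_to_adjoin[of a t] by blast
      then show ?thesis using t q \<phi>(2) \<iota> by (intro exI[of _ \<psi>]) auto
    next
      case True
      then obtain p where p: "over B p" "p \<noteq> 0" "poly p a = 0"
        and min: "\<And>f. over B f \<Longrightarrow> poly f a = 0 \<Longrightarrow> f \<noteq> 0 \<Longrightarrow> degree p \<le> degree f"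
        using ex_has_least_nat[of "\<lambda>p. over B p \<and> poly p a = 0 \<and> p \<noteq> 0" _ degree] by blast
      obtain u where u: "over B u" "poly u a * poly q a \<in> B" "poly u a * poly q a \<noteq> 0"
        using algebraic_has_multiple_in_base[OF p min q(1,3)] by blast
      let ?h = "poly u a * poly q a"
      have "lead_coeff p * ?h \<in> B" "lead_coeff p * ?h \<noteq> 0"
        using p u by (auto intro: mult over_coeff)
      then obtain \<phi> where \<phi>: "partial_hom B \<phi>" "\<forall>c. \<phi> (\<iota> c) = c" "\<phi> (lead_coeff p * ?h) \<noteq> 0"
        using assms unfolding enough_points_def by metis
      interpret partial_hom B \<phi> by fact
      have nz: "\<phi> (lead_coeff p) \<noteq> 0" "\<phi> ?h \<noteq> 0"
        using \<phi>(3) hom_mult[OF over_coeff[OF p(1)] u(2)] by auto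
      have "degree p \<noteq> 0"
        using p by (metis degree_eq_zeroE poly_const_conv pCons_0_0)
      moreover have "degree (map_poly \<phi> p) \<ge> degree p"
        using nz(1) by (intro le_degree) (simp add: coeff_map)
      ultimately obtain t where t: "poly (map_poly \<phi> p) t = 0"
        using alg_closed_imp_poly_has_root[of "map_poly \<phi> p"] by auto
      obtain \<psi> where \<psi>: "partial_hom (adjoin B a) \<psi>"
          "\<And>f. over B f \<Longrightarrow> \<psi> (poly f a) = poly (map_poly \<phi> f) t" "\<And>x. x \<in> B \<Longrightarrow> \<psi> x = \<phi> x"
        using extend_to_adjoin[of a t] minimal_relation_suffices[OF p min nz(1) t] by blast
      have "poly u a \<in> adjoin B a" using u(1) by (auto simp: adjoin_def)
      then have "\<psi> ?h = \<psi> (poly u a) * \<psi> g"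
        using partial_hom.hom_mult[OF \<psi>(1)] g(1) q(2) by simp
      then have "\<psi> g \<noteq> 0" using \<psi>(3)[OF u(2)] nz(2) by auto
      then show ?thesis using \<psi> \<phi>(2) \<iota> by (intro exI[of _ \<psi>]) auto
    qed
  qed
  then show ?thesis
    using subring_adjoin[of a] subset_adjoin[of a] \<iota> unfolding enough_points_def by blast
qed

lemma partial_hom_to_base:
  fixes \<iota> :: "'f::alg_closed_field \<Rightarrow> 'k::field"
  assumes \<iota>: "partial_hom UNIV \<iota>" "inj \<iota>" and S: "finite S"
  obtains B and \<phi> :: "'k \<Rightarrow> 'f" where "partial_hom B \<phi>" "S \<subseteq> B"
proof -
  interpret \<iota>: partial_hom UNIV \<iota> by fact
  have base: "enough_points \<iota> (range \<iota>)"
  proof -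
    interpret R: subring_of "range \<iota>"
    proof
      show "0 \<in> range \<iota>" "1 \<in> range \<iota>"
        using \<iota>.hom_zero \<iota>.hom_one by (metis rangeI)+
    next
      fix x y assume "x \<in> range \<iota>" "y \<in> range \<iota>"
      then show "x + y \<in> range \<iota>" "x * y \<in> range \<iota>"
        using \<iota>.hom_add \<iota>.hom_mult by (auto simp flip: \<iota>.hom_add \<iota>.hom_mult)
    next
      fix x assume "x \<in> range \<iota>"
      then show "- x \<in> range \<iota>" by (auto simp flip: \<iota>.hom_uminus)
    qed
    have inv: "inv \<iota> (\<iota> c) = c" for c using \<iota>(2) by simp
    have "partial_hom (range \<iota>) (inv \<iota>)"
    proof
      show "inv \<iota> 1 = 1" using inv[of 1] \<iota>.hom_one by simp
      fix x y assume "x \<in> range \<iota>" "y \<in> range \<iota>"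
      then show "inv \<iota> (x + y) = inv \<iota> x + inv \<iota> y" "inv \<iota> (x * y) = inv \<iota> x * inv \<iota> y"
        by (auto simp: inv simp flip: \<iota>.hom_add \<iota>.hom_mult)
    qed
    moreover have "inv \<iota> g \<noteq> 0" if "g \<in> range \<iota>" "g \<noteq> 0" for g
      using that \<iota>.hom_zero by (auto simp: inv)
    ultimately show ?thesis
      using R.subring_of_axioms inv unfolding enough_points_def by blast
  qed
  have "\<exists>B. enough_points \<iota> B \<and> S \<subseteq> B"
    using S
  proof (induction S)
    case empty
    then show ?case using base by blast
  next
    case (insert a S)
    then obtain B where B: "enough_points \<iota> B" "S \<subseteq> B" by blast
    then interpret subring_of B by (simp add: enough_points_def)
    show ?case
      using B enough_points_adjoin[OF B(1)] subset_adjoin[of a] generator_in_adjoin[of a]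
      by (intro exI[of _ "adjoin B a"]) auto
  qed
  then obtain B where B: "enough_points \<iota> B" "S \<subseteq> B" by blast
  \<comment> \<open>The element 1 is nonzero, so \<open>B\<close> has at least one point.\<close>
  then have "1 \<in> B" by (simp add: enough_points_def subring_of.one)
  then show ?thesis
    using B that unfolding enough_points_def by (metis zero_neq_one)
qed


section \<open>Homomorphic images of sums-of-squares formulas\<close>

abbreviation (input) lookup :: "('m \<Rightarrow>\<^sub>0 'a::zero) \<Rightarrow> 'm \<Rightarrow> 'a" where
  "lookup \<equiv> Poly_Mapping.lookup"

abbreviation (input) keys :: "('m \<Rightarrow>\<^sub>0 'a::zero) \<Rightarrow> 'm set" where
  "keys \<equiv> Poly_Mapping.keys"

text \<open>
  A relation rather than a map on polynomials: the sums and products that form the two sides of a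
  formula over \<open>B\<close> and of its image can then be related piece by piece. An identity between
  the sides passes to the images because a polynomial has at most one image.
\<close>
definition coeff_image ::
  "'a set \<Rightarrow> ('a \<Rightarrow> 'b) \<Rightarrow> ('m \<Rightarrow>\<^sub>0 'a::zero) \<Rightarrow> ('m \<Rightarrow>\<^sub>0 'b::zero) \<Rightarrow> bool" where
  "coeff_image B \<phi> p q \<longleftrightarrow> (\<forall>m. lookup p m \<in> B \<and> lookup q m = \<phi> (lookup p m))"

lemma coeff_image_unique: "coeff_image B \<phi> p q \<Longrightarrow> coeff_image B \<phi> p q' \<Longrightarrow> q = q'"
  by (auto simp: coeff_image_def intro: poly_mapping_eqI)

lemma lookup_mult_finite:
  fixes p q :: "'m::monoid_add \<Rightarrow>\<^sub>0 'a::semiring_0"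
  assumes "finite P" "keys p \<subseteq> P" "finite Q" "keys q \<subseteq> Q"
  shows "lookup (p * q) m = (\<Sum>l\<in>P. \<Sum>k\<in>Q. if m = l + k then lookup p l * lookup q k else 0)"
proof -
  have inner: "(\<Sum>k. lookup q k when m = l + k) = (\<Sum>k\<in>Q. lookup q k when m = l + k)" for l
    using assms by (intro Sum_any.expand_superset) (auto simp: in_keys_iff)
  have "lookup (p * q) m = (\<Sum>l\<in>P. lookup p l * (\<Sum>k\<in>Q. lookup q k when m = l + k))"
    unfolding lookup_mult inner
    by (intro Sum_any.expand_superset assms(1)) (auto intro!: subsetD[OF assms(2)] simp: in_keys_iff)
  also have "\<dots> = (\<Sum>l\<in>P. \<Sum>k\<in>Q. if m = l + k then lookup p l * lookup q k else 0)"
    by (auto simp: sum_distrib_left when_def intro!: sum.cong)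
  finally show ?thesis .
qed

context partial_hom
begin

lemma coeff_image_single: "c \<in> B \<Longrightarrow> coeff_image B \<phi> (Poly_Mapping.single m c) (Poly_Mapping.single m (\<phi> c))"
  by (auto simp: coeff_image_def lookup_single when_def hom_zero zero)

lemma coeff_image_add:
  "coeff_image B \<phi> p p' \<Longrightarrow> coeff_image B \<phi> q q' \<Longrightarrow> coeff_image B \<phi> (p + q) (p' + q')"
  by (simp add: coeff_image_def lookup_add hom_add add)

lemma coeff_image_sum:
  "(\<And>i. i \<in> I \<Longrightarrow> coeff_image B \<phi> (f i) (f' i)) \<Longrightarrow> coeff_image B \<phi> (sum f I) (sum f' I)"
proof (induction I rule: infinite_finite_induct)
  case (insert i I)
  then show ?case by (simp add: coeff_image_add)
qed (simp_all add: coeff_image_def hom_zero zero)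

lemma coeff_image_mult:
  fixes p q :: "'m::monoid_add \<Rightarrow>\<^sub>0 'a"
  assumes "coeff_image B \<phi> p p'" "coeff_image B \<phi> q q'"
  shows "coeff_image B \<phi> (p * q) (p' * q')"
proof -
  have "keys p' \<subseteq> keys p" "keys q' \<subseteq> keys q"
    using assms by (auto simp: coeff_image_def in_keys_iff hom_zero)
  then have image: "lookup (p' * q') m = (\<Sum>l\<in>keys p. \<Sum>k\<in>keys q.
      if m = l + k then lookup p' l * lookup q' k else 0)" for m
    by (intro lookup_mult_finite) auto
  let ?t = "\<lambda>m l k. if m = l + k then lookup p l * lookup q k else 0"
  have product: "lookup (p * q) m =
      (\<Sum>l\<in>keys p. \<Sum>k\<in>keys q. ?t m l k)" for m
    by (intro lookup_mult_finite) auto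
  have coeffs: "lookup p l \<in> B" "lookup q l \<in> B"
    "lookup p' l = \<phi> (lookup p l)"
    "lookup q' l = \<phi> (lookup q l)" for l
    using assms by (auto simp: coeff_image_def)
  have t: "?t m l k \<in> B" for m l k
    by (simp add: coeffs mult zero)
  have "lookup (p' * q') m =
      (\<Sum>l\<in>keys p. \<Sum>k\<in>keys q. \<phi> (?t m l k))" for m
    unfolding image by (intro sum.cong refl) (simp add: coeffs hom_mult hom_zero)
  then have "lookup (p' * q') m = \<phi> (lookup (p * q) m)" for m
    by (simp only: product hom_sum sum t)
  moreover have "lookup (p * q) m \<in> B" for m
    unfolding product by (intro sum t)
  ultimately show ?thesis by (simp add: coeff_image_def)
qed

lemma coeff_image_poly_const: "c \<in> B \<Longrightarrow> coeff_image B \<phi> (poly_const c) (poly_const (\<phi> c))"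
  unfolding poly_const_def by (rule coeff_image_single)

lemma coeff_image_poly_var: "coeff_image B \<phi> (poly_var v) (poly_var v)"
  unfolding poly_var_def using coeff_image_single[OF one] by (simp add: hom_one)

lemma sos_formula_image:
  assumes z: "\<And>i. i \<in> {1..n} \<Longrightarrow>
      z i = (\<Sum>j=1..r. \<Sum>k=1..s. poly_const (\<alpha> i j k) * poly_var (X j) * poly_var (Y k))"
    and \<alpha>: "\<And>i j k. i \<in> {1..n} \<Longrightarrow> j \<in> {1..r} \<Longrightarrow> k \<in> {1..s} \<Longrightarrow> \<alpha> i j k \<in> B"
    and sos: "sos_formula r s n z"
  shows "\<exists>z'. sos_formula r s n (z' :: nat \<Rightarrow> 'b xypoly)"
proof -
  define z' :: "nat \<Rightarrow> 'b xypoly" where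
    "z' i = (\<Sum>j=1..r. \<Sum>k=1..s. poly_const (\<phi> (\<alpha> i j k)) * poly_var (X j) * poly_var (Y k))" for i
  have zz': "coeff_image B \<phi> (z i) (z' i)" if "i \<in> {1..n}" for i
    unfolding z[OF that] z'_def
    by (intro coeff_image_sum coeff_image_mult coeff_image_poly_const coeff_image_poly_var \<alpha> that)
  have "coeff_image B \<phi> (\<Sum>i=1..n. z i ^ 2) (\<Sum>i=1..n. z' i ^ 2)"
    unfolding power2_eq_square by (intro coeff_image_sum coeff_image_mult zz')
  moreover have "coeff_image B \<phi>
      ((\<Sum>j=1..r. poly_var (X j) ^ 2) * (\<Sum>k=1..s. poly_var (Y k) ^ 2))
      ((\<Sum>j=1..r. poly_var (X j) ^ 2) * (\<Sum>k=1..s. poly_var (Y k) ^ 2))"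
    unfolding power2_eq_square
    by (intro coeff_image_sum coeff_image_mult coeff_image_poly_var)
  ultimately have "(\<Sum>j=1..r. poly_var (X j) ^ 2) * (\<Sum>k=1..s. poly_var (Y k) ^ 2)
      = (\<Sum>i=1..n. z' i ^ 2)"
    using sos by (auto simp: sos_formula_def intro: coeff_image_unique)
  moreover have "bilinear_expr r s (z' i)" for i
    unfolding bilinear_expr_def z'_def by (rule exI[of _ "\<lambda>j k. \<phi> (\<alpha> i j k)"]) simp
  ultimately show ?thesis unfolding sos_formula_def by blast
qed

end

lemma sos_formula_coefficients:
  assumes "sos_formula r s n z"
  obtains \<alpha> where "\<And>i. i \<in> {1..n} \<Longrightarrow>
      z i = (\<Sum>j=1..r. \<Sum>k=1..s. poly_const (\<alpha> i j k) * poly_var (X j) * poly_var (Y k))"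
proof -
  have "\<forall>i\<in>{1..n}. \<exists>\<alpha>. z i =
      (\<Sum>j=1..r. \<Sum>k=1..s. poly_const (\<alpha> j k) * poly_var (X j) * poly_var (Y k))"
    using assms unfolding sos_formula_def bilinear_expr_def by blast
  from bchoice[OF this] show ?thesis using that by blast
qed

theorem theorem1p1:
  fixes r s n :: nat
    and \<iota> :: "'f::alg_closed_field \<Rightarrow> 'k::alg_closed_field"
  assumes "r > 0" and "s > 0" and "n > 0"
    and "CHAR('f) \<noteq> 2" and "CHAR('k) \<noteq> 2"
    and "inj \<iota>"
    and "\<iota> 0 = 0" and "\<iota> 1 = 1"
    and "\<And>a b. \<iota> (a + b) = \<iota> a + \<iota> b"
    and "\<And>a b. \<iota> (a * b) = \<iota> a * \<iota> b"
  shows "(\<exists>z :: nat \<Rightarrow> 'f xypoly. sos_formula r s n z) \<longleftrightarrow>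
         (\<exists>z :: nat \<Rightarrow> 'k xypoly. sos_formula r s n z)"
proof
  have \<iota>: "partial_hom UNIV \<iota>"
    using assms by unfold_locales auto
  {
    assume "\<exists>z :: nat \<Rightarrow> 'f xypoly. sos_formula r s n z"
    then obtain z :: "nat \<Rightarrow> 'f xypoly" where z: "sos_formula r s n z" by blast
    from sos_formula_coefficients[OF z] obtain \<alpha> where "\<And>i. i \<in> {1..n} \<Longrightarrow>
        z i = (\<Sum>j=1..r. \<Sum>k=1..s. poly_const (\<alpha> i j k) * poly_var (X j) * poly_var (Y k))"
      by blast
    from partial_hom.sos_formula_image[OF \<iota> this _ z]
    show "\<exists>z :: nat \<Rightarrow> 'k xypoly. sos_formula r s n z" by simp
  next
    assume "\<exists>z :: nat \<Rightarrow> 'k xypoly. sos_formula r s n z"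
    then obtain z :: "nat \<Rightarrow> 'k xypoly" where z: "sos_formula r s n z" by blast
    from sos_formula_coefficients[OF z] obtain \<alpha> where \<alpha>: "\<And>i. i \<in> {1..n} \<Longrightarrow>
        z i = (\<Sum>j=1..r. \<Sum>k=1..s. poly_const (\<alpha> i j k) * poly_var (X j) * poly_var (Y k))"
      by blast
    define S where "S = (\<lambda>(i, j, k). \<alpha> i j k) ` ({1..n} \<times> {1..r} \<times> {1..s})"
    have "finite S" by (simp add: S_def)
    then obtain B and \<phi> :: "'k \<Rightarrow> 'f" where \<phi>: "partial_hom B \<phi>" "S \<subseteq> B"
      using partial_hom_to_base[OF \<iota> assms(6)] by blast
    have "\<alpha> i j k \<in> B" if "i \<in> {1..n}" "j \<in> {1..r}" "k \<in> {1..s}" for i j k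
      using that \<phi>(2) by (force simp: S_def)
    from partial_hom.sos_formula_image[OF \<phi>(1) \<alpha> this z]
    show "\<exists>z :: nat \<Rightarrow> 'f xypoly. sos_formula r s n z" by blast
  }
qed

end
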